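(* Let $w_1,\dots,w_n$ ($n\geqslant 1$) be pairwise different nonempty words over an alphabet $\Sigma$. The language $w_1^*+\ldots+w_n^*$ can be generated by a context-free grammar with exactly one nonterminal if and only if the words $w_1,\dots,w_n$ commute pairwise, i.e. $w_iw_j=w_jw_i$ for all $i,j\in\{1,\dots,n\}$.
   Context: Alphabets are finite. $w^*=\{w^m : m\geqslant 0\}$ (with $w^0=\varepsilon$ the empty word), and $+$ denotes union of languages, so $w_1^*+\ldots+w_n^*=\bigcup_{i=1}^n\{w_i^m : m\geqslant 0\}$. A context-free grammar is a tuple $(N,\Sigma,P,S)$ with finite set of nonterminals $N$ (also called variables), terminal alphabet $\Sigma$, finite set $P$ of productions $A\to\alpha$ with $A\in N$, $\alpha\in(N\cup\Sigma)^*$ (productions $A\to\varepsilon$ are allowed), and start symbol $S\in N$. *)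

theory Defs
  imports Main
begin

text \<open>
  The two constructors keep nonterminals and terminals disjoint, whatever the types
  \<open>'n\<close> and \<open>'t\<close> are.
\<close>

datatype ('n, 't) symbol = Nt 'n | Tm 't

record ('n, 't) grammar =
  nonterminals :: "'n set"
  terminals :: "'t set"
  productions :: "('n \<times> ('n, 't) symbol list) set"
  start :: 'n

definition context_free_grammar :: "('n, 't) grammar \<Rightarrow> bool" where
  "context_free_grammar G \<longleftrightarrow>
     finite (nonterminals G) \<and> finite (terminals G) \<and> finite (productions G) \<and>
     start G \<in> nonterminals G \<and>
     productions G \<subseteq> nonterminals G \<times> lists (Nt ` nonterminals G \<union> Tm ` terminals G)"

inductive derives1 :: "('n, 't) grammar \<Rightarrow> ('n, 't) symbol list \<Rightarrow> ('n, 't) symbol list \<Rightarrow> bool"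
  for G where
  "(A, \<alpha>) \<in> productions G \<Longrightarrow> derives1 G (u @ [Nt A] @ v) (u @ \<alpha> @ v)"

definition language_of :: "('n, 't) grammar \<Rightarrow> 't list set" where
  "language_of G = {w \<in> lists (terminals G). (derives1 G)\<^sup>*\<^sup>* [Nt (start G)] (map Tm w)}"

definition word_power :: "'t list \<Rightarrow> nat \<Rightarrow> 't list" where
  "word_power w m = concat (replicate m w)"

definition word_star :: "'t list \<Rightarrow> 't list set" where
  "word_star w = {word_power w m | m. m \<ge> 0}"

end

theory Submission
  imports Defs
begin

text \<open>
  Suppose one nonterminal \<open>S\<close> suffices. As the empty word is in the language \<open>L\<close>, occurrences
  of \<open>S\<close> can be erased at will, and as \<open>L\<close> is infinite some production
  other than \<open>S \<rightarrow> S\<close> contains \<open>S\<close>. Hence either \<open>L\<close> is closed under \<open>x \<mapsto> \<alpha> x \<beta>\<close> for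
  some terminal words \<open>\<alpha>\<close>, \<open>\<beta>\<close> with \<open>\<alpha> \<beta>\<close> nonempty, or \<open>L\<close> is closed under concatenation.
  By a weak form of the Fine--Wilf theorem, \<open>u\<^sup>p y \<in> L\<close> with \<open>p\<close> large forces \<open>u\<close> and \<open>y\<close> to
  commute. Applying this to \<open>\<alpha>\<^sup>p w\<^sub>i\<^sup>q \<beta>\<^sup>p\<close>, to \<open>w\<^sub>i\<^sup>p \<beta>\<close> if \<open>\<alpha>\<close> is empty, or to \<open>w\<^sub>i\<^sup>p w\<^sub>j\<close>
  gives the claim, since words commuting with a common nonempty word commute with each other.
  Conversely, pairwise commuting words have a common power \<open>z = w\<^sub>i\<^bsup>k i\<^esup>\<close>, and the
  productions \<open>S \<rightarrow> z S\<close> and \<open>S \<rightarrow> w\<^sub>i\<^sup>m\<close> with \<open>m < k i\<close> generate the language.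
\<close>

subsection \<open>Powers and commuting words\<close>

lemma word_power_0 [simp]: "word_power u 0 = []"
  by (simp add: word_power_def)

lemma word_power_Suc: "word_power u (Suc m) = u @ word_power u m"
  by (simp add: word_power_def)

lemma word_power_1 [simp]: "word_power u (Suc 0) = u"
  by (simp add: word_power_def)

lemma length_word_power [simp]: "length (word_power u m) = m * length u"
  by (induction m) (auto simp: word_power_Suc)

lemma word_power_add: "word_power u (m + k) = word_power u m @ word_power u k"
  by (induction m) (auto simp: word_power_Suc)

lemma word_power_mult: "word_power u (m * k) = word_power (word_power u m) k"
  by (induction k) (auto simp: word_power_Suc word_power_add)

lemma word_power_Suc2: "word_power u (Suc m) = word_power u m @ u"
  using word_power_add[of u m 1] by simp

lemma word_power_in_lists: "u \<in> lists A \<Longrightarrow> word_power u m \<in> lists A"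
  by (induction m) (auto simp: word_power_Suc)

lemma word_power_eq_Nil_iff [simp]: "word_power u m = [] \<longleftrightarrow> m = 0 \<or> u = []"
  by (cases m) (auto simp: word_power_def)

lemma word_star_eq_range: "word_star u = range (word_power u)"
  by (auto simp: word_star_def)

lemma commute_word_power:
  assumes "u @ v = v @ u"
  shows "u @ word_power v m = word_power v m @ u"
proof (induction m)
  case (Suc m)
  have "u @ word_power v (Suc m) = v @ u @ word_power v m"
    using assms by (metis append.assoc word_power_Suc)
  then show ?case using Suc by (simp add: word_power_Suc)
qed simp

lemma commute_word_powers:
  assumes "u @ v = v @ u"
  shows "word_power u k @ word_power v m = word_power v m @ word_power u k"
  by (metis assms commute_word_power)

lemma commute_length_eq:
  assumes "u @ v = v @ u" "length u = length v"
  shows "u = v"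
  using assms by (metis append_eq_append_conv)

text \<open>Both powers have length \<open>length u * length v\<close>, and powers of commuting
  words commute, so \<open>commute_length_eq\<close> applies.\<close>

lemma commute_common_power:
  assumes "u @ v = v @ u"
  shows "word_power u (length v) = word_power v (length u)"
  by (rule commute_length_eq) (auto simp: commute_word_powers[OF assms])

text \<open>A weak Fine--Wilf theorem: both \<open>u @ v\<close> and \<open>v @ u\<close> are prefixes of the common word.\<close>

lemma power_prefix_commute:
  assumes eq: "word_power u (Suc p) @ s = word_power v (Suc r)"
    and len: "length v \<le> p * length u"
  shows "u @ v = v @ u"
proof -
  define z where "z = word_power v (Suc r)"
  have lz: "length z = Suc p * length u + length s" "length z = Suc r * length v"
    using arg_cong[OF eq, of length] by (auto simp: z_def)
  \<comment> \<open>Since \<open>Suc r * length v\<close> is at least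
    \<open>Suc p * length u\<close>, removing \<open>length v \<le> p * length u\<close> still
    leaves room for one copy of \<open>u\<close>.\<close>
  then have len': "length u \<le> r * length v"
    using len by simp
  have "z = word_power u (Suc p) @ s"
    by (simp add: eq z_def)
  \<comment> \<open>Peeling off the front copy of \<open>u\<close> shows what follows it, namely
    \<open>word_power u p\<close>; shifting it behind shows that this power starts like
    \<open>z\<close>, hence with \<open>v\<close>. The roles of \<open>u\<close> and
    \<open>v\<close> are then exchanged.\<close>
  then have zu: "z = u @ word_power u p @ s" "z = word_power u p @ u @ s"
    by (simp add: word_power_Suc, simp add: word_power_Suc2)
  have zv: "z = v @ word_power v r" "z = word_power v r @ v"
    by (simp add: z_def word_power_Suc, simp add: z_def word_power_Suc2)
  have "take (length v) (word_power u p) = take (length v) z"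
    using len by (subst zu(2)) simp
  also have "\<dots> = v"
    by (subst zv(1)) simp
  finally have 1: "take (length u + length v) z = u @ v"
    using len by (subst zu(1)) simp
  have "take (length u) (word_power v r) = take (length u) z"
    using len' by (subst zv(2)) simp
  also have "\<dots> = u"
    by (subst zu(1)) simp
  finally have "take (length u + length v) z = v @ u"
    using len' by (subst zv(1)) simp
  with 1 show ?thesis by simp
qed

text \<open>Raising the equation to the power \<open>c = Suc (length v)\<close> makes the common
  word long enough for \<open>power_prefix_commute\<close>, used with empty
  \<open>s\<close>.\<close>

lemma common_power_commute:
  assumes eq: "word_power u k = word_power v m" and "k > 0" "u \<noteq> []" "v \<noteq> []"
  shows "u @ v = v @ u"
proof -
  define c where "c = Suc (length v)"
  have "m > 0" using assms by (cases m) auto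
  obtain p where p: "k * c = Suc p" using \<open>k > 0\<close> by (metis c_def Suc_pred mult_pos_pos zero_less_Suc)
  obtain r where r: "m * c = Suc r" using \<open>m > 0\<close> by (metis c_def Suc_pred mult_pos_pos zero_less_Suc)
  have "length v \<le> p"
  proof -
    have "1 * c \<le> k * c" using \<open>k > 0\<close> by (intro mult_right_mono) auto
    then show ?thesis using p by (simp add: c_def)
  qed
  also have "p \<le> p * length u" using \<open>u \<noteq> []\<close> by (cases u) auto
  finally have "length v \<le> p * length u" .
  moreover have "word_power u (Suc p) @ [] = word_power v (Suc r)"
    using eq by (simp flip: p r add: word_power_mult)
  ultimately show ?thesis by (rule power_prefix_commute[rotated])
qed

text \<open>Through powers of \<open>t\<close>, the words \<open>u\<close> and \<open>v\<close>
  acquire a common nonempty power, of length \<open>length u * length v * length t\<close>.\<close>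

lemma commute_trans:
  assumes "u @ t = t @ u" "v @ t = t @ v" "t \<noteq> []"
  shows "u @ v = v @ u"
proof (cases "u = [] \<or> v = []")
  case False
  have "word_power u (length t * length v) = word_power (word_power t (length u)) (length v)"
    by (simp add: word_power_mult commute_common_power[OF assms(1)])
  also have "\<dots> = word_power (word_power t (length v)) (length u)"
    by (simp flip: word_power_mult add: mult.commute)
  also have "\<dots> = word_power v (length t * length u)"
    by (simp add: word_power_mult commute_common_power[OF assms(2)])
  finally show ?thesis
    by (rule common_power_commute) (use False assms(3) in auto)
qed auto

text \<open>The commuting word \<open>y\<close> and \<open>v\<close> satisfy
  \<open>word_power y (length v) = word_power v (length y)\<close>, and the left side begins with
  the long power of \<open>u\<close>, so \<open>power_prefix_commute\<close> applies.\<close>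

lemma commute_long_prefix:
  assumes comm: "(word_power u (Suc p) @ s) @ v = v @ (word_power u (Suc p) @ s)"
    and "length v \<le> p" "u \<noteq> []" "v \<noteq> []"
  shows "u @ v = v @ u"
proof -
  define y where "y = word_power u (Suc p) @ s"
  obtain l where l: "length v = Suc l" using \<open>v \<noteq> []\<close> by (cases v) auto
  have "length y > 0" using \<open>u \<noteq> []\<close> by (simp add: y_def)
  then obtain r where r: "length y = Suc r" by (cases "length y") auto
  have "word_power y (length v) = word_power v (length y)"
    by (rule commute_common_power) (use comm in \<open>simp add: y_def\<close>)
  then have "word_power u (Suc p) @ (s @ word_power y l) = word_power v (Suc r)"
    unfolding l r word_power_Suc[of y] by (simp add: y_def)
  moreover have "length v \<le> p * length u"
    using \<open>length v \<le> p\<close> \<open>u \<noteq> []\<close> by (cases u) (auto intro: trans_le_add1)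
  ultimately show ?thesis by (rule power_prefix_commute)
qed

text \<open>The long prefix makes \<open>u\<close> commute with \<open>v\<close>, hence with the
  whole word, which is a power of \<open>v\<close>. Cancelling \<open>word_power u (Suc K)\<close>
  leaves \<open>y\<close>.\<close>

lemma long_prefix_of_star_commute:
  assumes "word_power u (Suc K) @ y \<in> word_star v" "length v \<le> K" "u \<noteq> []"
  shows "u @ y = y @ u"
proof -
  obtain r where r: "word_power u (Suc K) @ y = word_power v r"
    using assms(1) by (auto simp: word_star_eq_range)
  have "r \<noteq> 0" using r \<open>u \<noteq> []\<close> by (intro notI) (simp add: word_power_Suc)
  then obtain q where q: "r = Suc q" by (cases r) auto
  have "length v \<le> K * length u"
    using assms(2,3) by (cases u) (auto intro: trans_le_add1)
  then have "u @ v = v @ u"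
    using power_prefix_commute[of u K y v q] r q by simp
  then have "u @ word_power u (Suc K) @ y = (word_power u (Suc K) @ y) @ u"
    unfolding r by (rule commute_word_power)
  then have "word_power u (Suc K) @ (u @ y) = word_power u (Suc K) @ (y @ u)"
    by (metis append.assoc commute_word_power)
  then show ?thesis by simp
qed

subsection \<open>Derivations\<close>

lemma derives1_context:
  assumes "derives1 G x y"
  shows "derives1 G (u @ x @ v) (u @ y @ v)"
  using assms
proof cases
  case (1 A \<alpha> u' v')
  then show ?thesis using derives1.intros[of A \<alpha> G "u @ u'" "v' @ v"] by simp
qed

lemma derives_context:
  assumes "(derives1 G)\<^sup>*\<^sup>* x y"
  shows "(derives1 G)\<^sup>*\<^sup>* (u @ x @ v) (u @ y @ v)"
  using assms
  by (induction rule: rtranclp_induct) (auto intro: rtranclp.rtrancl_into_rtrancl derives1_context)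

lemma derives_append:
  assumes "(derives1 G)\<^sup>*\<^sup>* x x'" "(derives1 G)\<^sup>*\<^sup>* y y'"
  shows "(derives1 G)\<^sup>*\<^sup>* (x @ y) (x' @ y')"
  using derives_context[OF assms(1), of "[]" y] derives_context[OF assms(2), of x' "[]"]
  by (auto intro: rtranclp_trans)

lemma derives_production:
  assumes "(A, \<gamma>) \<in> productions G"
  shows "(derives1 G)\<^sup>*\<^sup>* [Nt A] \<gamma>"
  using derives1.intros[OF assms, of "[]" "[]"] by auto

text \<open>This is the terminal word that remains when every nonterminal derives the empty
  word.\<close>

fun erase :: "('n, 't) symbol list \<Rightarrow> 't list" where
  "erase [] = []"
| "erase (Nt A # \<gamma>) = erase \<gamma>"
| "erase (Tm t # \<gamma>) = t # erase \<gamma>"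

lemma erase_append [simp]: "erase (a @ b) = erase a @ erase b"
  by (induction a rule: erase.induct) auto

lemma erase_in_lists:
  assumes "set \<gamma> \<subseteq> Nt ` N \<union> Tm ` T"
  shows "erase \<gamma> \<in> lists T"
  using assms by (induction \<gamma> rule: erase.induct) auto

lemma derives_erase:
  assumes "(derives1 G)\<^sup>*\<^sup>* [Nt S] []" "set \<gamma> \<subseteq> Nt ` {S} \<union> Tm ` T"
  shows "(derives1 G)\<^sup>*\<^sup>* \<gamma> (map Tm (erase \<gamma>))"
  using assms(2)
proof (induction \<gamma> rule: erase.induct)
  case (2 A \<gamma>)
  then show ?case using derives_append[OF assms(1), of \<gamma> "map Tm (erase \<gamma>)"] by auto
next
  case (3 t \<gamma>)
  then show ?case
    using derives_append[OF rtranclp.rtrancl_refl, of G \<gamma> "map Tm (erase \<gamma>)" "[Tm t]"] by auto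
qed auto

section \<open>Closure properties of languages with a one-nonterminal grammar\<close>

locale unary_grammar =
  fixes G :: "('n, 't) grammar" and S :: 'n
  assumes cfg: "context_free_grammar G"
    and nonterminals: "nonterminals G = {S}"
begin

lemma start [simp]: "start G = S"
  using cfg nonterminals by (auto simp: context_free_grammar_def)

lemma production_symbols:
  assumes "(A, \<gamma>) \<in> productions G"
  shows "A = S" "set \<gamma> \<subseteq> Nt ` {S} \<union> Tm ` terminals G"
  using cfg nonterminals assms by (fastforce simp: context_free_grammar_def)+

lemma language_memI:
  "w \<in> lists (terminals G) \<Longrightarrow> (derives1 G)\<^sup>*\<^sup>* [Nt S] (map Tm w) \<Longrightarrow> w \<in> language_of G"
  by (simp add: language_of_def)

lemma language_memD:
  assumes "w \<in> language_of G"
  shows "w \<in> lists (terminals G)" "(derives1 G)\<^sup>*\<^sup>* [Nt S] (map Tm w)"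
  using assms by (auto simp: language_of_def)

lemma derives_Nil: "[] \<in> language_of G \<Longrightarrow> (derives1 G)\<^sup>*\<^sup>* [Nt S] []"
  using language_memD(2)[of "[]"] by simp

text \<open>The displayed occurrence of \<open>S\<close> derives \<open>x\<close>, while all
  occurrences in \<open>a\<close> and \<open>b\<close> are erased.\<close>

lemma language_closed_context:
  assumes "[] \<in> language_of G" "(S, a @ Nt S # b) \<in> productions G" "x \<in> language_of G"
  shows "erase a @ x @ erase b \<in> language_of G"
proof (rule language_memI)
  have sub: "set a \<subseteq> Nt ` {S} \<union> Tm ` terminals G" "set b \<subseteq> Nt ` {S} \<union> Tm ` terminals G"
    using production_symbols(2)[OF assms(2)] by auto
  show "erase a @ x @ erase b \<in> lists (terminals G)"
    using erase_in_lists[OF sub(1)] erase_in_lists[OF sub(2)] language_memD(1)[OF assms(3)]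
    by simp
  have "(derives1 G)\<^sup>*\<^sup>* [Nt S] (a @ [Nt S] @ b)"
    using derives_production[OF assms(2)] by simp
  also have "(derives1 G)\<^sup>*\<^sup>* \<dots> (map Tm (erase a) @ map Tm x @ map Tm (erase b))"
    by (intro derives_append derives_erase[OF derives_Nil[OF assms(1)], where T = "terminals G"] sub
        language_memD(2)[OF assms(3)])
  finally show "(derives1 G)\<^sup>*\<^sup>* [Nt S] (map Tm (erase a @ x @ erase b))"
    by simp
qed

lemma language_closed_append:
  assumes "[] \<in> language_of G" "(S, Nt S # Nt S # \<gamma>) \<in> productions G" "erase \<gamma> = []"
    and "x \<in> language_of G" "y \<in> language_of G"
  shows "x @ y \<in> language_of G"
proof (rule language_memI)
  show "x @ y \<in> lists (terminals G)"
    using language_memD(1)[OF assms(4)] language_memD(1)[OF assms(5)] by simp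
  have sub: "set \<gamma> \<subseteq> Nt ` {S} \<union> Tm ` terminals G"
    using production_symbols(2)[OF assms(2)] by auto
  have "(derives1 G)\<^sup>*\<^sup>* [Nt S] ([Nt S] @ [Nt S] @ \<gamma>)"
    using derives_production[OF assms(2)] by simp
  also have "(derives1 G)\<^sup>*\<^sup>* \<dots> (map Tm x @ map Tm y @ map Tm (erase \<gamma>))"
    by (intro derives_append derives_erase[OF derives_Nil[OF assms(1)], where T = "terminals G"] sub
        language_memD(2)[OF assms(4)] language_memD(2)[OF assms(5)])
  finally show "(derives1 G)\<^sup>*\<^sup>* [Nt S] (map Tm (x @ y))"
    using assms(3) by simp
qed

text \<open>Every form reachable from \<open>S\<close> is \<open>[Nt S]\<close> or the right-hand
  side of a production, because a further step can only start from \<open>[Nt S]\<close>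
  itself.\<close>

lemma language_finite:
  assumes "\<And>\<gamma>. (S, \<gamma>) \<in> productions G \<Longrightarrow> Nt S \<in> set \<gamma> \<Longrightarrow> \<gamma> = [Nt S]"
  shows "finite (language_of G)"
proof -
  have reach: "\<gamma> = [Nt S] \<or> (S, \<gamma>) \<in> productions G" if "(derives1 G)\<^sup>*\<^sup>* [Nt S] \<gamma>" for \<gamma>
    using that
  proof (induction rule: rtranclp_induct)
    case (step y z)
    from step(2) show ?case
    proof cases
      case (1 A \<alpha> u v)
      then have A: "A = S" using production_symbols by blast
      then have "y = [Nt S]" using step(3) assms[of y] 1(1) by auto
      then show ?thesis using 1 A by (auto simp: append_eq_Cons_conv)
    qed
  qed simp
  have "map Tm ` language_of G \<subseteq> insert [Nt S] (snd ` productions G)"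
    using reach language_memD(2) by force
  moreover have "finite (productions G)"
    using cfg by (simp add: context_free_grammar_def)
  ultimately have "finite (map Tm ` language_of G :: ('n, 't) symbol list set)"
    by (meson finite_imageI finite_insert finite_subset)
  then show ?thesis
    by (rule finite_imageD) (auto intro!: inj_onI simp: map_injective inj_def)
qed

lemma language_closure_cases:
  assumes "[] \<in> language_of G" "infinite (language_of G)"
  obtains (surround) \<alpha> \<beta> where "\<alpha> @ \<beta> \<noteq> []"
      "\<And>x. x \<in> language_of G \<Longrightarrow> \<alpha> @ x @ \<beta> \<in> language_of G"
    | (concatenate) "\<And>x y. x \<in> language_of G \<Longrightarrow> y \<in> language_of G \<Longrightarrow> x @ y \<in> language_of G"
proof -
  obtain \<gamma> where \<gamma>: "(S, \<gamma>) \<in> productions G" "Nt S \<in> set \<gamma>" "\<gamma> \<noteq> [Nt S]"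
    using language_finite assms(2) by blast
  show thesis
  proof (cases "erase \<gamma> = []")
    case False
    obtain a b where ab: "\<gamma> = a @ Nt S # b" using \<gamma>(2) by (meson split_list)
    show thesis
      by (rule surround[of "erase a" "erase b"])
        (use False ab language_closed_context[OF assms(1)] \<gamma>(1) in auto)
  next
    \<comment> \<open>Here \<open>\<gamma>\<close> consists of copies of \<open>S\<close> only, and
      at least two of them; the copies after the second are erased.\<close>
    case True
    have hd: "\<exists>\<delta>'. \<delta> = Nt S # \<delta>' \<and> erase \<delta>' = []"
      if "erase \<delta> = []" "set \<delta> \<subseteq> set \<gamma>" "\<delta> \<noteq> []" for \<delta>
      using that production_symbols(2)[OF \<gamma>(1)] by (cases \<delta> rule: erase.cases) auto
    obtain \<delta> where \<delta>: "\<gamma> = Nt S # \<delta>" "erase \<delta> = []" using hd[of \<gamma>] True \<gamma>(2) by fastforce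
    then obtain \<epsilon> where "\<delta> = Nt S # \<epsilon>" "erase \<epsilon> = []" using hd[of \<delta>] \<gamma>(3) by auto
    then show thesis using concatenate language_closed_append[OF assms(1)] \<gamma>(1) \<delta> by blast
  qed
qed

end

subsection \<open>From a grammar to commutation\<close>

lemma unary_grammar_imp_commute:
  fixes w :: "'i \<Rightarrow> 't list"
  assumes "unary_grammar G S" and "finite I"
    and ne: "\<And>i. i \<in> I \<Longrightarrow> w i \<noteq> []"
    and L: "language_of G = (\<Union>i\<in>I. word_star (w i))"
    and ij: "i \<in> I" "j \<in> I"
  shows "w i @ w j = w j @ w i"
proof -
  interpret unary_grammar G S by fact
  \<comment> \<open>It is not known which \<open>word_star (w l)\<close> contains a given word of
    the language, so \<open>K\<close> bounds the lengths of all generators at once.\<close>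
  define K where "K = Max ((length \<circ> w) ` I)"
  have K: "length (w l) \<le> K" if "l \<in> I" for l
    using that \<open>finite I\<close> by (auto simp: K_def)
  have pow: "word_power (w l) m \<in> language_of G" if "l \<in> I" for l m
    using that by (auto simp: L word_star_eq_range)
  have Nil: "[] \<in> language_of G" using pow[OF ij(1), of 0] by simp
  have "inj (word_power (w i))"
  proof (rule injI)
    fix p q assume "word_power (w i) p = word_power (w i) q"
    from arg_cong[OF this, of length] show "p = q" using ne[OF ij(1)] by simp
  qed
  then have inf: "infinite (language_of G)"
    using pow[OF ij(1)] by (auto simp: infinite_iff_countable_subset)
  have comm: "u @ y = y @ u" if "word_power u (Suc K) @ y \<in> language_of G" "u \<noteq> []" for u y
    using that long_prefix_of_star_commute[of u K y] K unfolding L by blast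
  show ?thesis
  proof (rule language_closure_cases[OF Nil inf])
    fix \<alpha> \<beta> assume ne\<alpha>\<beta>: "\<alpha> @ \<beta> \<noteq> []"
      and closed: "\<And>x. x \<in> language_of G \<Longrightarrow> \<alpha> @ x @ \<beta> \<in> language_of G"
    \<comment> \<open>The witness \<open>t\<close> is \<open>\<alpha>\<close> if it is nonempty, and
      \<open>\<beta>\<close> otherwise.\<close>
    have "\<exists>t. t \<noteq> [] \<and> (\<forall>l\<in>I. w l @ t = t @ w l)"
    proof (cases "\<alpha> = []")
      case True
      have "w l @ \<beta> = \<beta> @ w l" if "l \<in> I" for l
        using closed[OF pow[OF that, of "Suc K"]] True by (intro comm ne that) simp
      then show ?thesis using True ne\<alpha>\<beta> by auto
    next
      case False
      have iter: "word_power \<alpha> m @ x @ word_power \<beta> m \<in> language_of G"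
        if "x \<in> language_of G" for m x
      proof (induction m)
        case (Suc m)
        from closed[OF this] show ?case by (metis append.assoc word_power_Suc word_power_Suc2)
      qed (simp add: that)
      have "w l @ \<alpha> = \<alpha> @ w l" if "l \<in> I" for l
      proof (rule commute_long_prefix)
        \<comment> \<open>Surrounding the power of \<open>w l\<close> \<open>Suc K\<close> times
          gives \<open>word_power \<alpha> (Suc K) @ ?y\<close> in the language, so
          \<open>\<alpha>\<close> commutes with \<open>?y\<close>. The exponent of
          \<open>w l\<close> is what \<open>commute_long_prefix\<close> requires.\<close>
        let ?y = "word_power (w l) (Suc (length \<alpha>)) @ word_power \<beta> (Suc K)"
        show "?y @ \<alpha> = \<alpha> @ ?y"
          by (rule comm[symmetric]) (use iter pow that False in auto)
      qed (use ne that False in auto)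
      then show ?thesis using False by blast
    qed
    then show ?thesis using commute_trans ij by blast
  next
    assume "\<And>x y. x \<in> language_of G \<Longrightarrow> y \<in> language_of G \<Longrightarrow> x @ y \<in> language_of G"
    then have "word_power (w i) (Suc K) @ w j \<in> language_of G"
      using pow[OF ij(1), of "Suc K"] pow[OF ij(2), of 1] by simp
    then show ?thesis by (rule comm) (rule ne[OF ij(1)])
  qed
qed

subsection \<open>From commutation to a grammar\<close>

definition right_linear_grammar ::
    "'n \<Rightarrow> 't set \<Rightarrow> 't list \<Rightarrow> 't list set \<Rightarrow> ('n, 't) grammar" where
  "right_linear_grammar S T z F =
     \<lparr>nonterminals = {S}, terminals = T,
      productions = insert (S, map Tm z @ [Nt S]) ((\<lambda>x. (S, map Tm x)) ` F), start = S\<rparr>"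

lemma right_linear_grammar_simps [simp]:
  "nonterminals (right_linear_grammar S T z F) = {S}"
  "terminals (right_linear_grammar S T z F) = T"
  "start (right_linear_grammar S T z F) = S"
  "productions (right_linear_grammar S T z F) =
     insert (S, map Tm z @ [Nt S]) ((\<lambda>x. (S, map Tm x)) ` F)"
  by (simp_all add: right_linear_grammar_def)

lemma context_free_right_linear_grammar:
  assumes "finite T" "finite F" "F \<subseteq> lists T" "z \<in> lists T"
  shows "context_free_grammar (right_linear_grammar S T z F)"
  using assms by (auto 0 4 simp: context_free_grammar_def dest: subsetD)

text \<open>The recursive production keeps a single nonterminal at the right end, and a production
  from \<open>F\<close> ends the derivation.\<close>

lemma right_linear_grammar_derives:
  assumes "(derives1 (right_linear_grammar S T z F))\<^sup>*\<^sup>* [Nt S] \<gamma>"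
  shows "(\<exists>m. \<gamma> = map Tm (word_power z m) @ [Nt S]) \<or>
         (\<exists>m. \<exists>x\<in>F. \<gamma> = map Tm (word_power z m @ x))"
  using assms
proof (induction rule: rtranclp_induct)
  case base
  show ?case by (rule disjI1, rule exI[of _ 0]) simp
next
  case (step \<gamma> \<delta>)
  from step(2) show ?case
  proof cases
    case (1 A \<alpha> u v)
    have "Nt A \<in> set \<gamma>" using 1 by simp
    then obtain m where m: "\<gamma> = map Tm (word_power z m) @ [Nt S]"
      using step(3) by auto
    \<comment> \<open>The only nonterminal of \<open>\<gamma>\<close> is its last symbol; with
      \<open>v\<close> nonempty, \<open>butlast\<close> would leave \<open>Nt A\<close> inside a
      terminal word.\<close>
    have "v = []"
    proof (rule ccontr)
      assume "v \<noteq> []"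
      then have "u @ Nt A # butlast v = map Tm (word_power z m)"
        using arg_cong[of _ _ butlast, OF trans[OF 1(1)[symmetric] m]] by (simp add: butlast_append)
      then have "Nt A \<in> set (map Tm (word_power z m))"
        by (metis in_set_conv_decomp)
      then show False by auto
    qed
    then have u: "u = map Tm (word_power z m)" using 1(1) m by simp
    from 1(3) consider "\<alpha> = map Tm z @ [Nt S]" | x where "x \<in> F" "\<alpha> = map Tm x"
      by auto
    then show ?thesis
    proof cases
      assume "\<alpha> = map Tm z @ [Nt S]"
      then have "\<delta> = map Tm (word_power z (Suc m)) @ [Nt S]"
        using 1(2) u \<open>v = []\<close> by (simp add: word_power_Suc2)
      then show ?thesis by blast
    next
      fix x assume "x \<in> F" "\<alpha> = map Tm x"
      then show ?thesis using 1(2) u \<open>v = []\<close> by auto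
    qed
  qed
qed

lemma language_of_right_linear_grammar:
  fixes S :: 'n and T :: "'t set"
  assumes "F \<subseteq> lists T" "z \<in> lists T"
  shows "language_of (right_linear_grammar S T z F) = {word_power z m @ x | m x. x \<in> F}"
    (is "language_of ?G = ?L")
proof (intro equalityI subsetI)
  fix y assume "y \<in> language_of ?G"
  then have "(derives1 ?G)\<^sup>*\<^sup>* [Nt S] (map Tm y)"
    by (simp add: language_of_def)
  from right_linear_grammar_derives[OF this]
  obtain m x where "x \<in> F" and eq: "map Tm y = (map Tm (word_power z m @ x) :: ('n, 't) symbol list)"
  proof (elim disjE exE bexE)
    fix m assume "map Tm y = map Tm (word_power z m) @ [Nt S]"
    then have "Nt S \<in> set (map Tm y)" by (metis in_set_conv_decomp)
    then show thesis by auto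
  qed
  have "y = word_power z m @ x"
    by (rule map_injective[OF eq]) (simp add: inj_def)
  with \<open>x \<in> F\<close> show "y \<in> ?L" by blast
next
  fix y assume "y \<in> ?L"
  then obtain m x where y: "y = word_power z m @ x" and x: "x \<in> F" by blast
  have "(derives1 ?G)\<^sup>*\<^sup>* [Nt S] (map Tm (word_power z m @ x))"
  proof (induction m)
    case 0
    show ?case using x by (auto intro: derives_production)
  next
    case (Suc m)
    have "(derives1 ?G)\<^sup>*\<^sup>* [Nt S] (map Tm z @ [Nt S])"
      by (rule derives_production) simp
    also have "(derives1 ?G)\<^sup>*\<^sup>* \<dots> (map Tm z @ map Tm (word_power z m @ x))"
      by (intro derives_append Suc rtranclp.rtrancl_refl)
    finally show ?case by (simp add: word_power_Suc)
  qed
  moreover have "y \<in> lists T"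
    using x y assms word_power_in_lists[OF assms(2), of m] by auto
  ultimately show "y \<in> language_of ?G" by (simp add: language_of_def y)
qed

lemma pairwise_commute_common_power:
  assumes "finite I" "I \<noteq> {}" "\<And>i. i \<in> I \<Longrightarrow> w i \<noteq> []"
    and comm: "\<And>i j. i \<in> I \<Longrightarrow> j \<in> I \<Longrightarrow> w i @ w j = w j @ w i"
  obtains z k where "\<And>i. i \<in> I \<Longrightarrow> k i > 0 \<and> z = word_power (w i) (k i)"
proof -
  obtain a where a: "a \<in> I" using \<open>I \<noteq> {}\<close> by blast
  \<comment> \<open>Multiplying by \<open>length (w i)\<close> completes the product over
    \<open>I\<close>, so all \<open>word_power (w i) (k i)\<close> have the same length; as they
    commute, they coincide.\<close>
  define k where "k i = length (w a) * (\<Prod>j\<in>I - {i}. length (w j))" for i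
  have len: "k i * length (w i) = length (w a) * (\<Prod>j\<in>I. length (w j))" if "i \<in> I" for i
    using prod.remove[OF \<open>finite I\<close> that, of "\<lambda>j. length (w j)"] by (simp add: k_def)
  show thesis
  proof
    fix i assume i: "i \<in> I"
    have "k i > 0" using assms(3) a by (auto simp: k_def intro!: prod_pos)
    moreover have "word_power (w a) (k a) = word_power (w i) (k i)"
      by (rule commute_length_eq)
        (use commute_word_powers[OF comm[OF a i]] len[OF i] len[OF a] in auto)
    ultimately show "k i > 0 \<and> word_power (w a) (k a) = word_power (w i) (k i)" ..
  qed
qed

lemma commute_imp_unary_grammar:
  fixes w :: "'i \<Rightarrow> 't list" and S :: 'n
  assumes "finite T" "finite I" "I \<noteq> {}"
    and w: "\<And>i. i \<in> I \<Longrightarrow> w i \<noteq> [] \<and> w i \<in> lists T"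
    and comm: "\<And>i j. i \<in> I \<Longrightarrow> j \<in> I \<Longrightarrow> w i @ w j = w j @ w i"
  obtains z F where "context_free_grammar (right_linear_grammar S T z F)"
    "language_of (right_linear_grammar S T z F) = (\<Union>i\<in>I. word_star (w i))"
proof -
  obtain z k where k: "\<And>i. i \<in> I \<Longrightarrow> k i > 0 \<and> z = word_power (w i) (k i)"
    by (rule pairwise_commute_common_power[of I w]) (use assms(2,3) w in \<open>auto intro: comm\<close>)
  \<comment> \<open>These are the remainders of exponents modulo \<open>k i\<close>: dividing
    \<open>m\<close> by \<open>k i\<close> splits \<open>word_power (w i) m\<close> into a power of
    \<open>z\<close> and a word of \<open>F\<close>.\<close>
  define F where "F = (\<Union>i\<in>I. word_power (w i) ` {..<k i})"
  have fin: "finite F" using \<open>finite I\<close> by (simp add: F_def)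
  have F: "F \<subseteq> lists T" unfolding F_def
    by (intro UN_least image_subsetI word_power_in_lists) (use w in blast)
  obtain a where a: "a \<in> I" using \<open>I \<noteq> {}\<close> by blast
  then have z: "z \<in> lists T" using w[OF a] k[OF a] by (metis word_power_in_lists)
  have zF: "word_power z m @ word_power (w i) r = word_power (w i) (k i * m + r)" if "i \<in> I" for i m r
    unfolding word_power_add word_power_mult using k[OF that] by metis
  have "{word_power z m @ x | m x. x \<in> F} = (\<Union>i\<in>I. word_star (w i))"
  proof (intro equalityI subsetI)
    fix y assume "y \<in> (\<Union>i\<in>I. word_star (w i))"
    then obtain i m where i: "i \<in> I" and y: "y = word_power (w i) m"
      by (auto simp: word_star_eq_range)
    have "y = word_power z (m div k i) @ word_power (w i) (m mod k i)"
      by (simp only: zF[OF i] y mult_div_mod_eq)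
    moreover have "word_power (w i) (m mod k i) \<in> F"
      unfolding F_def by (intro UN_I[OF i] imageI) (use k[OF i] in simp)
    ultimately show "y \<in> {word_power z m @ x | m x. x \<in> F}" by blast
  next
    fix y assume "y \<in> {word_power z m @ x | m x. x \<in> F}"
    then obtain m i r where "i \<in> I" "y = word_power z m @ word_power (w i) r"
      by (auto simp: F_def)
    then show "y \<in> (\<Union>i\<in>I. word_star (w i))"
      by (auto simp only: zF word_star_eq_range)
  qed
  then show thesis
    using that[OF context_free_right_linear_grammar[OF \<open>finite T\<close> fin F z]]
    by (simp only: language_of_right_linear_grammar[OF F z])
qed

theorem theorem3p2:
  fixes \<Sigma> :: "'t set" and w :: "nat \<Rightarrow> 't list" and n :: nat
  assumes "finite \<Sigma>"
    and "n \<ge> 1"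
    and "\<forall>i\<in>{1..n}. w i \<in> lists \<Sigma> \<and> w i \<noteq> []"
    and "\<forall>i\<in>{1..n}. \<forall>j\<in>{1..n}. i \<noteq> j \<longrightarrow> w i \<noteq> w j"
  shows "(\<exists>G :: ('n, 't) grammar.
            context_free_grammar G \<and> terminals G = \<Sigma> \<and> card (nonterminals G) = 1 \<and>
            language_of G = (\<Union>i\<in>{1..n}. word_star (w i)))
         \<longleftrightarrow> (\<forall>i\<in>{1..n}. \<forall>j\<in>{1..n}. w i @ w j = w j @ w i)"
proof
  assume "\<exists>G :: ('n, 't) grammar.
            context_free_grammar G \<and> terminals G = \<Sigma> \<and> card (nonterminals G) = 1 \<and>
            language_of G = (\<Union>i\<in>{1..n}. word_star (w i))"
  then obtain G :: "('n, 't) grammar" and S where "unary_grammar G S"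
    and "language_of G = (\<Union>i\<in>{1..n}. word_star (w i))"
    by (metis card_1_singletonE unary_grammar.intro)
  then show "\<forall>i\<in>{1..n}. \<forall>j\<in>{1..n}. w i @ w j = w j @ w i"
    using unary_grammar_imp_commute[of G S "{1..n}" w] assms(3) by blast
next
  assume "\<forall>i\<in>{1..n}. \<forall>j\<in>{1..n}. w i @ w j = w j @ w i"
  then have comm: "w i @ w j = w j @ w i" if "i \<in> {1..n}" "j \<in> {1..n}" for i j
    using that by blast
  \<comment> \<open>Any element of \<open>'n\<close> can serve as the nonterminal;
    \<open>undefined\<close> supplies one.\<close>
  obtain z F where
    "context_free_grammar (right_linear_grammar (undefined :: 'n) \<Sigma> z F)"
    "language_of (right_linear_grammar (undefined :: 'n) \<Sigma> z F) = (\<Union>i\<in>{1..n}. word_star (w i))"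
    by (rule commute_imp_unary_grammar[of \<Sigma> "{1..n}" w]) (use assms(1-3) comm in auto)
  then show "\<exists>G :: ('n, 't) grammar.
            context_free_grammar G \<and> terminals G = \<Sigma> \<and> card (nonterminals G) = 1 \<and>
            language_of G = (\<Union>i\<in>{1..n}. word_star (w i))"
    by (intro exI[of _ "right_linear_grammar undefined \<Sigma> z F"]) simp
qed

end
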